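(* Let $C(E)=E^b$ with $b\in\mathbb R$, $b\ge1$. Then the cost $\underline C_{max}$ obtained by the Online Full Attack satisfies $$\underline C_{max}\ \ge\ \frac{1}{r_1^{\,b-1}}\,C_{max},\qquad\text{where } r_1=\left\lceil\frac{l_{max}}{l_{min}}\right\rceil+1 .$$
   Context: Total-energy model, full attack. Time is slotted with slots $1,\dots,T$; $[k,l]$ denotes the set of slots $\{k,\dots,l\}$. There are $n\ge1$ jobs $J=\{1,\dots,n\}$; job $j$ has demand $(a_j,d_j,e_j)$ with $a_j,d_j\in\{1,\dots,T\}$, $a_j\le d_j$, $e_j>0$ (arrival slot, deadline slot, total energy). The job allowance is $l_j=d_j-a_j+1$, and $l_{max}=\max_{j\in J} l_j$, $l_{min}=\min_{j\in J} l_j$. Optimal offline full attack cost: each job $j$ is served entirely in one slot $t_j\in[a_j,d_j]$, and $$C_{max}=C_{max}(a,d,e)=\max_{t_j\in[a_j,d_j],\,j\in J}\ \sum_{t=1}^T C\Big(\sum_{j\in J:\,t_j=t}e_j\Big).$$ Online Full Attack: the attacker maintains a set $A$ of active jobs, initially empty. In each slot $t=1,\dots,T$ in turn: (1) add to $A$ all jobs $j$ with $a_j=t$; (2) if some job $j\in A$ has $d_j=t$, then every job $k\in A$ is forged to have $a'_k=d'_k=t$ (so that it is served entirely in slot $t$), the jobs in $A$ are forwarded to the operator, and $A$ is reset to $\emptyset$. Let $K_1,\dots,K_m$ be the successive sets of jobs grouped together in this way (a partition of $J$). The resulting cost is $$\underline C_{max}=\sum_{i=1}^m C\Big(\sum_{j\in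 K_i}e_j\Big).$$ *)

theory Defs
  imports Complex_Main "HOL-Library.FuncSet"
begin

text \<open>
  The jobs are \<^term>\<open>{1..n}\<close>; job \<^term>\<open>j\<close> has arrival slot \<^term>\<open>a j\<close>, deadline slot
  \<^term>\<open>d j\<close> and total energy \<^term>\<open>e j\<close>. Values outside \<^term>\<open>{1..n}\<close> are irrelevant.
  The slots are \<^term>\<open>{1..T}\<close>.
\<close>

definition valid_demands ::
    "nat \<Rightarrow> nat \<Rightarrow> (nat \<Rightarrow> nat) \<Rightarrow> (nat \<Rightarrow> nat) \<Rightarrow> (nat \<Rightarrow> real) \<Rightarrow> bool" where
  "valid_demands T n a d e \<longleftrightarrow>
     (\<forall>j\<in>{1..n}. a j \<in> {1..T} \<and> d j \<in> {1..T} \<and> a j \<le> d j \<and> e j > 0)"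

definition allowance :: "(nat \<Rightarrow> nat) \<Rightarrow> (nat \<Rightarrow> nat) \<Rightarrow> nat \<Rightarrow> nat" where
  "allowance a d j = d j - a j + 1"

definition l_max :: "nat \<Rightarrow> (nat \<Rightarrow> nat) \<Rightarrow> (nat \<Rightarrow> nat) \<Rightarrow> nat" where
  "l_max n a d = Max (allowance a d ` {1..n})"

definition l_min :: "nat \<Rightarrow> (nat \<Rightarrow> nat) \<Rightarrow> (nat \<Rightarrow> nat) \<Rightarrow> nat" where
  "l_min n a d = Min (allowance a d ` {1..n})"

definition r1 :: "nat \<Rightarrow> (nat \<Rightarrow> nat) \<Rightarrow> (nat \<Rightarrow> nat) \<Rightarrow> int" where
  "r1 n a d = \<lceil>real (l_max n a d) / real (l_min n a d)\<rceil> + 1"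

definition schedules :: "nat \<Rightarrow> (nat \<Rightarrow> nat) \<Rightarrow> (nat \<Rightarrow> nat) \<Rightarrow> (nat \<Rightarrow> nat) set" where
  "schedules n a d = (\<Pi>\<^sub>E j\<in>{1..n}. {a j..d j})"

definition schedule_cost ::
    "(real \<Rightarrow> real) \<Rightarrow> nat \<Rightarrow> nat \<Rightarrow> (nat \<Rightarrow> real) \<Rightarrow> (nat \<Rightarrow> nat) \<Rightarrow> real" where
  "schedule_cost C T n e s = (\<Sum>t=1..T. C (\<Sum>j | j \<in> {1..n} \<and> s j = t. e j))"

definition offline_cost ::
    "(real \<Rightarrow> real) \<Rightarrow> nat \<Rightarrow> nat \<Rightarrow> (nat \<Rightarrow> nat) \<Rightarrow> (nat \<Rightarrow> nat) \<Rightarrow> (nat \<Rightarrow> real) \<Rightarrow> real" where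
  "offline_cost C T n a d e = Max (schedule_cost C T n e ` schedules n a d)"

text \<open>The maximum ranges over a finite, nonempty set.\<close>

lemma finite_schedules: "finite (schedules n a d)"
  unfolding schedules_def by (intro finite_PiE) auto

lemma schedules_nonempty:
  assumes "valid_demands T n a d e"
  shows "schedules n a d \<noteq> {}"
  using assms by (auto simp: schedules_def PiE_eq_empty_iff valid_demands_def)

text \<open>
  The state of the online attack after slot \<^term>\<open>t\<close>: the set of active jobs, and the list
  \<open>K\<^sub>1, \<dots>, K\<^sub>m\<close> of the groups forwarded so far.
\<close>

fun online_state ::
    "nat \<Rightarrow> (nat \<Rightarrow> nat) \<Rightarrow> (nat \<Rightarrow> nat) \<Rightarrow> nat \<Rightarrow> nat set \<times> nat set list" where
  "online_state n a d 0 = ({}, [])"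
| "online_state n a d (Suc t) =
     (let (A, Ks) = online_state n a d t;
          A' = A \<union> {j \<in> {1..n}. a j = Suc t}
      in if \<exists>j\<in>A'. d j = Suc t then ({}, Ks @ [A']) else (A', Ks))"

definition online_groups ::
    "nat \<Rightarrow> nat \<Rightarrow> (nat \<Rightarrow> nat) \<Rightarrow> (nat \<Rightarrow> nat) \<Rightarrow> nat set list" where
  "online_groups T n a d = snd (online_state n a d T)"

definition online_cost ::
    "(real \<Rightarrow> real) \<Rightarrow> nat \<Rightarrow> nat \<Rightarrow> (nat \<Rightarrow> nat) \<Rightarrow> (nat \<Rightarrow> nat) \<Rightarrow> (nat \<Rightarrow> real) \<Rightarrow> real" where
  "online_cost C T n a d e = (\<Sum>K\<leftarrow>online_groups T n a d. C (\<Sum>j\<in>K. e j))"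

end

theory Submission
  imports Defs "HOL-Analysis.Convex"
begin

text \<open>
  The online attack closes its groups at slots \<open>0 = \<tau> 0 < \<tau> 1 < \<dots> < \<tau> m\<close>, and the \<open>i\<close>-th group
  consists of the jobs arriving in \<open>(\<tau> i, \<tau> (i + 1)]\<close>. One of these jobs has deadline \<open>\<tau> (i + 1)\<close>,
  so consecutive closing slots are at least \<open>l\<^sub>m\<^sub>i\<^sub>n\<close> apart. The jobs that a schedule serves in one
  slot all arrive within a window of \<open>l\<^sub>m\<^sub>a\<^sub>x\<close> slots, which meets at most \<open>r\<^sub>1\<close> groups. Split the energy
  of each slot by groups: convexity of the power function bounds the cost of the slot by
  \<open>r\<^sub>1\<close> to the power \<open>b - 1\<close> times the cost of its parts, and superadditivity over the slots bounds
  the total cost of the parts of a group by the cost of that group.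
\<close>

section \<open>Inequalities for sums of powers\<close>

text \<open>Split \<open>x i powr b\<close> as \<open>x i * x i powr (b - 1)\<close> and enlarge the
  base of the second factor to the whole sum; the first factors then add up.\<close>

lemma sum_powr_le_powr_sum:
  fixes x :: "'a \<Rightarrow> real"
  assumes "finite I" "\<And>i. i \<in> I \<Longrightarrow> x i \<ge> 0" "b \<ge> 1"
  shows "(\<Sum>i\<in>I. x i powr b) \<le> (\<Sum>i\<in>I. x i) powr b"
proof -
  let ?S = "\<Sum>i\<in>I. x i"
  have split: "y powr b = y * y powr (b - 1)" if "y \<ge> 0" for y :: real
    using that powr_mult_base[of y "b - 1"] by simp
  have "(\<Sum>i\<in>I. x i powr b) \<le> (\<Sum>i\<in>I. x i * ?S powr (b - 1))"
  proof (intro sum_mono)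
    fix i assume "i \<in> I"
    then have "x i \<le> ?S" using assms by (intro member_le_sum) auto
    then show "x i powr b \<le> x i * ?S powr (b - 1)"
      using \<open>i \<in> I\<close> assms by (subst split) (auto intro!: mult_left_mono powr_mono2)
  qed
  also have "\<dots> = ?S powr b"
    using assms by (simp add: split sum_nonneg flip: sum_distrib_right)
  finally show ?thesis .
qed

text \<open>Jensen's inequality with equal weights. It is applied on the open half-line, hence the
  strict positivity of the \<open>x i\<close>.\<close>

lemma powr_sum_le_card_powr:
  fixes x :: "'a \<Rightarrow> real"
  assumes "finite I" "\<And>i. i \<in> I \<Longrightarrow> x i > 0" "b \<ge> 1"
  shows "(\<Sum>i\<in>I. x i) powr b \<le> real (card I) powr (b - 1) * (\<Sum>i\<in>I. x i powr b)"
proof (cases "I = {}")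
  case False
  let ?c = "real (card I)"
  have c: "?c > 0" using False assms(1) by (simp add: card_gt_0_iff)
  have "(\<Sum>i\<in>I. (1 / ?c) *\<^sub>R x i) powr b \<le> (\<Sum>i\<in>I. (1 / ?c) * x i powr b)"
    by (rule convex_on_sum[where C = "{0<..}"])
      (use c False assms powr_convex[of b] in \<open>auto\<close>)
  then have "((\<Sum>i\<in>I. x i) / ?c) powr b \<le> (\<Sum>i\<in>I. x i powr b) / ?c"
    by (simp flip: sum_divide_distrib)
  then have "(\<Sum>i\<in>I. x i) powr b / ?c powr b \<le> (\<Sum>i\<in>I. x i powr b) / ?c"
    using c assms by (simp add: powr_divide sum_nonneg less_imp_le)
  then have "(\<Sum>i\<in>I. x i) powr b \<le> (\<Sum>i\<in>I. x i powr b) / ?c * ?c powr b"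
    using c by (subst (asm) pos_divide_le_eq) auto
  then have "(\<Sum>i\<in>I. x i) powr b \<le> (?c powr b / ?c) * (\<Sum>i\<in>I. x i powr b)"
    by (simp add: mult.commute)
  also have "?c powr b / ?c = ?c powr (b - 1)"
    using c by (simp add: powr_diff)
  finally show ?thesis .
qed simp

section \<open>Closing slots of the online attack\<close>

text \<open>Loop invariant, by induction on the slot: \<open>\<tau> m\<close> is the last closing
  slot so far (\<open>0\<close> before the first), and the active jobs are those that arrived since,
  all with deadlines still ahead.\<close>

lemma online_state_closing_slots:
  assumes "valid_demands T n a d e"
    and "\<And>j. j \<in> {1..n} \<Longrightarrow> l \<le> allowance a d j"
  shows "\<exists>\<tau> m. \<tau> 0 = 0 \<and> \<tau> m \<le> t \<and>
    (\<forall>i<m. \<tau> i < \<tau> (Suc i) \<and> \<tau> i + l \<le> \<tau> (Suc i)) \<and>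
    snd (online_state n a d t) = map (\<lambda>i. {j \<in> {1..n}. \<tau> i < a j \<and> a j \<le> \<tau> (Suc i)}) [0..<m] \<and>
    fst (online_state n a d t) = {j \<in> {1..n}. \<tau> m < a j \<and> a j \<le> t} \<and>
    (\<forall>j \<in> fst (online_state n a d t). t < d j)"
proof (induction t)
  case 0
  show ?case
    by (rule exI[of _ "\<lambda>_. 0"], rule exI[of _ 0])
      (use assms(1) in \<open>auto simp: valid_demands_def\<close>)
next
  case (Suc t)
  define B Ks where "B = fst (online_state n a d t)" and "Ks = snd (online_state n a d t)"
  from Suc.IH obtain \<tau> m where \<tau>: "\<tau> 0 = 0" "\<tau> m \<le> t"
    "\<forall>i<m. \<tau> i < \<tau> (Suc i) \<and> \<tau> i + l \<le> \<tau> (Suc i)"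
    "Ks = map (\<lambda>i. {j \<in> {1..n}. \<tau> i < a j \<and> a j \<le> \<tau> (Suc i)}) [0..<m]"
    "B = {j \<in> {1..n}. \<tau> m < a j \<and> a j \<le> t}"
    "\<forall>j \<in> B. t < d j"
    unfolding B_def Ks_def by blast
  define B' where "B' = B \<union> {j \<in> {1..n}. a j = Suc t}"
  have B': "B' = {j \<in> {1..n}. \<tau> m < a j \<and> a j \<le> Suc t}"
    using \<tau>(2,5) by (auto simp: B'_def)
  \<comment> \<open>Older active jobs are covered by the invariant, new ones by
    \<open>a j \<le> d j\<close>. If no deadline equals the current slot, the inequality becomes
    strict and the invariant is restored.\<close>
  have dB': "Suc t \<le> d j" if "j \<in> B'" for j
  proof (cases "j \<in> B")
    case True
    then show ?thesis using \<tau>(6) Suc_le_eq by blast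
  next
    case False
    then have "j \<in> {1..n}" "a j = Suc t" using that by (simp_all add: B'_def)
    then show ?thesis using assms(1) unfolding valid_demands_def by metis
  qed
  have state: "online_state n a d (Suc t) =
      (if \<exists>j\<in>B'. d j = Suc t then ({}, Ks @ [B']) else (B', Ks))"
    by (simp add: B'_def B_def Ks_def Let_def split_beta)
  show ?case
  proof (cases "\<exists>j\<in>B'. d j = Suc t")
    case True
    then obtain j where j: "j \<in> B'" "d j = Suc t" by auto
    define \<sigma> where "\<sigma> = \<tau>(Suc m := Suc t)"
    have \<sigma>: "\<sigma> (Suc m) = Suc t" "\<And>i. i \<le> m \<Longrightarrow> \<sigma> i = \<tau> i" by (simp_all add: \<sigma>_def)
    \<comment> \<open>The job due now arrived strictly after \<open>\<tau> m\<close>; this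
      compensates the \<open>+ 1\<close> in the allowance, so the gap is a full
      \<open>l\<close>.\<close>
    have "\<tau> m + l \<le> Suc t"
      using assms(2)[of j] j by (auto simp: B' allowance_def)
    then have "\<forall>i<Suc m. \<sigma> i < \<sigma> (Suc i) \<and> \<sigma> i + l \<le> \<sigma> (Suc i)"
      using \<tau>(2,3) by (auto simp: \<sigma> less_Suc_eq)
    moreover have "Ks @ [B'] = map (\<lambda>i. {j \<in> {1..n}. \<sigma> i < a j \<and> a j \<le> \<sigma> (Suc i)}) [0..<Suc m]"
      using \<sigma> by (simp add: \<tau>(4) B')
    moreover have "{} = {j \<in> {1..n}. \<sigma> (Suc m) < a j \<and> a j \<le> Suc t}"
      using \<sigma> by auto
    moreover have "\<sigma> 0 = 0" "\<sigma> (Suc m) \<le> Suc t" using \<sigma> \<tau>(1) by auto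
    moreover have "online_state n a d (Suc t) = ({}, Ks @ [B'])"
      using True by (simp only: state if_True)
    ultimately show ?thesis
      by (intro exI[of _ \<sigma>] exI[of _ "Suc m"]) (simp only: fst_conv snd_conv, blast)
  next
    case False
    have "\<forall>j\<in>B'. Suc t < d j"
      using False dB' by (metis le_neq_implies_less)
    moreover have "online_state n a d (Suc t) = (B', Ks)"
      using False by (simp only: state if_False)
    moreover have "\<tau> m \<le> Suc t" using \<tau>(2) by simp
    ultimately show ?thesis
      using \<tau>(1,3,4) B'
      by (intro exI[of _ \<tau>] exI[of _ m] conjI) (simp_all only: fst_conv snd_conv)
  qed
qed

text \<open>After slot \<open>T\<close> a job still active would have a deadline beyond
  \<open>T\<close>, so none is left and the groups cover all jobs.\<close>

lemma online_groups_closing_slots: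
  assumes "valid_demands T n a d e"
    and "\<And>j. j \<in> {1..n} \<Longrightarrow> l \<le> allowance a d j"
  obtains \<tau> m where "\<tau> 0 = 0"
    "\<And>i. i < m \<Longrightarrow> \<tau> i < \<tau> (Suc i) \<and> \<tau> i + l \<le> \<tau> (Suc i)"
    "online_groups T n a d = map (\<lambda>i. {j \<in> {1..n}. \<tau> i < a j \<and> a j \<le> \<tau> (Suc i)}) [0..<m]"
    "\<And>j. j \<in> {1..n} \<Longrightarrow> a j \<le> \<tau> m"
proof -
  define A where "A = fst (online_state n a d T)"
  obtain \<tau> m where \<tau>: "\<tau> 0 = 0"
    "\<forall>i<m. \<tau> i < \<tau> (Suc i) \<and> \<tau> i + l \<le> \<tau> (Suc i)"
    "online_groups T n a d = map (\<lambda>i. {j \<in> {1..n}. \<tau> i < a j \<and> a j \<le> \<tau> (Suc i)}) [0..<m]"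
    "A = {j \<in> {1..n}. \<tau> m < a j \<and> a j \<le> T}"
    "\<forall>j\<in>A. T < d j"
    using online_state_closing_slots[OF assms, where t = T]
    unfolding A_def online_groups_def by blast
  have "a j \<le> \<tau> m" if "j \<in> {1..n}" for j
  proof (rule ccontr)
    assume "\<not> a j \<le> \<tau> m"
    with that assms(1) have "j \<in> A" by (auto simp: \<tau>(4) valid_demands_def)
    then have "T < d j" using \<tau>(5) by blast
    moreover have "d j \<le> T" using that assms(1) by (simp add: valid_demands_def)
    ultimately show False by simp
  qed
  with \<tau>(1-3) show thesis by (intro that[of \<tau> m]) simp_all
qed

section \<open>Sequences with gaps bounded below\<close>

lemma steps_le:
  fixes \<tau> :: "nat \<Rightarrow> nat"
  assumes "\<And>i. i < m \<Longrightarrow> \<tau> i + l \<le> \<tau> (Suc i)" "i + k \<le> m"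
  shows "\<tau> i + k * l \<le> \<tau> (i + k)"
  using assms(2)
proof (induction k)
  case (Suc k)
  then show ?case using assms(1)[of "i + k"] by simp
qed simp

text \<open>Together with \<open>step_interval_unique\<close>, this makes the group of a job a
  function of the job.\<close>

lemma ex_step_interval:
  fixes \<tau> :: "nat \<Rightarrow> nat"
  assumes "\<tau> 0 < x" "x \<le> \<tau> m"
  shows "\<exists>i<m. \<tau> i < x \<and> x \<le> \<tau> (Suc i)"
  using assms(2)
proof (induction m)
  case 0
  then show ?case using assms(1) by simp
next
  case (Suc m)
  show ?case
  proof (cases "x \<le> \<tau> m")
    case True
    then show ?thesis using Suc.IH less_SucI by blast
  next
    case False
    then show ?thesis using Suc.prems by (intro exI[of _ m]) simp
  qed
qed

lemma step_interval_unique: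
  fixes \<tau> :: "nat \<Rightarrow> nat"
  assumes "\<And>i. i < m \<Longrightarrow> \<tau> i \<le> \<tau> (Suc i)"
    and "i < m" "\<tau> i < x" "x \<le> \<tau> (Suc i)" "i' < m" "\<tau> i' < x" "x \<le> \<tau> (Suc i')"
  shows "i = i'"
proof -
  \<comment> \<open>Taking step length \<open>0\<close> in \<open>steps_le\<close> yields plain
    monotonicity.\<close>
  have mono: "\<tau> u \<le> \<tau> v" if "u \<le> v" "v \<le> m" for u v
    using steps_le[of m \<tau> 0 u "v - u"] assms(1) that by simp
  show ?thesis
    using mono[of "Suc i" i'] mono[of "Suc i'" i] assms(2-) by linarith
qed

text \<open>
  Apart from the first and the last one, the groups meeting the window \<open>(t - L, t]\<close> lie inside it.
\<close>
lemma card_steps_meeting_window: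
  fixes \<tau> :: "nat \<Rightarrow> nat"
  assumes step: "\<And>i. i < m \<Longrightarrow> \<tau> i + l \<le> \<tau> (Suc i)"
    and I: "I \<subseteq> {..<m}" "\<And>i. i \<in> I \<Longrightarrow> \<exists>x. \<tau> i < x \<and> x \<le> \<tau> (Suc i) \<and> x \<le> t \<and> t < x + L"
    and "l > 0"
  shows "int (card I) \<le> \<lceil>real L / real l\<rceil> + 1"
proof (cases "I = {}")
  case True
  then show ?thesis by (simp add: order_less_le_trans[of _ 0])
next
  case False
  have fin: "finite I" using I(1) finite_subset by blast
  define p q where "p = Min I" and "q = Max I"
  have pq: "p \<in> I" "q \<in> I" "p \<le> q" "I \<subseteq> {p..q}"
    using fin False by (auto simp: p_def q_def)
  have card: "card I \<le> Suc q - p" using card_mono[OF _ pq(4)] by simp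
  have c0: "\<lceil>real L / real l\<rceil> \<ge> 0" by (simp add: order_less_le_trans[of _ 0])
  show ?thesis
  proof (cases "p = q")
    case True
    then have "card I \<le> 1" using card by simp
    then show ?thesis using c0 by linarith
  next
    case False
    obtain x where x: "x \<le> \<tau> (Suc p)" "t < x + L" using I(2) pq by blast
    obtain y where y: "\<tau> q < y" "y \<le> t" using I(2) pq by blast
    have q: "q = Suc p + (q - Suc p)" using False pq by simp
    \<comment> \<open>The \<open>q - p - 1\<close> inner steps fit between \<open>x\<close> and
      \<open>y\<close>, which are less than \<open>L\<close> apart. Strictness keeps their number
      below the ceiling, so adding the two end steps costs only \<open>+ 1\<close>.\<close>
    have "\<tau> (Suc p) + (q - Suc p) * l \<le> \<tau> (Suc p + (q - Suc p))"
      by (rule steps_le[of m]) (use step I(1) pq q in auto)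
    then have "(q - Suc p) * l < L" using x y q by simp
    then have "real (q - Suc p) < real L / real l"
      using \<open>l > 0\<close> by (simp add: pos_less_divide_eq flip: of_nat_mult)
    then have "int (q - Suc p) < \<lceil>real L / real l\<rceil>"
      by (simp add: less_ceiling_iff)
    then show ?thesis using card q by linarith
  qed
qed

section \<open>Regrouping the energy and comparing the costs\<close>

text \<open>Here \<open>g j\<close> is the group and \<open>s j\<close> the slot of job \<open>j\<close>.\<close>
lemma sum_powr_regroup_le:
  fixes e :: "'j \<Rightarrow> real"
  assumes "finite J" "finite S" "finite G" "g ` J \<subseteq> G" "s ` J \<subseteq> S"
    and "\<And>j. j \<in> J \<Longrightarrow> e j > 0" "b \<ge> 1"
    and R: "\<And>t. t \<in> S \<Longrightarrow> real (card (g ` {j \<in> J. s j = t})) \<le> R"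
  shows "(\<Sum>t\<in>S. (\<Sum>j | j \<in> J \<and> s j = t. e j) powr b)
           \<le> R powr (b - 1) * (\<Sum>i\<in>G. (\<Sum>j | j \<in> J \<and> g j = i. e j) powr b)"
proof -
  define x where "x t i = (\<Sum>j | j \<in> J \<and> s j = t \<and> g j = i. e j)" for t i
  have x0: "x t i \<ge> 0" for t i unfolding x_def by (rule sum_nonneg) (use assms(6) less_imp_le in auto)
  \<comment> \<open>Only groups present in slot \<open>t\<close> enter the Jensen bound: their parts
    are positive, and their number is what \<open>R\<close> bounds.\<close>
  have x_pos: "x t i > 0" if i: "i \<in> g ` {j \<in> J. s j = t}" for t i
    unfolding x_def by (rule sum_pos) (use assms(1,6) i in auto)
  have slot: "(\<Sum>j | j \<in> J \<and> s j = t. e j) powr b \<le> R powr (b - 1) * (\<Sum>i\<in>G. x t i powr b)"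
    if "t \<in> S" for t
  proof -
    let ?I = "g ` {j \<in> J. s j = t}"
    have "(\<Sum>j | j \<in> J \<and> s j = t. e j) = (\<Sum>i\<in>?I. x t i)"
      using sum.group[of "{j \<in> J. s j = t}" ?I g e] assms(1)
      by (simp add: x_def conj_assoc)
    also have "\<dots> powr b \<le> real (card ?I) powr (b - 1) * (\<Sum>i\<in>?I. x t i powr b)"
      using assms(1,7) x_pos by (intro powr_sum_le_card_powr) auto
    also have "\<dots> \<le> R powr (b - 1) * (\<Sum>i\<in>G. x t i powr b)"
      using assms R[OF that] by (intro mult_mono powr_mono2 sum_mono2 sum_nonneg) auto
    finally show ?thesis .
  qed
  have grp: "(\<Sum>t\<in>S. x t i powr b) \<le> (\<Sum>j | j \<in> J \<and> g j = i. e j) powr b" for i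
  proof -
    have "(\<Sum>t\<in>S. x t i powr b) \<le> (\<Sum>t\<in>S. x t i) powr b"
      by (rule sum_powr_le_powr_sum) (use assms x0 in auto)
    also have "(\<Sum>t\<in>S. x t i) = (\<Sum>j | j \<in> J \<and> g j = i. e j)"
      using sum.group[of "{j \<in> J. g j = i}" S s e] assms(1,2,5)
      by (auto simp: x_def conj_ac image_subset_iff)
    finally show ?thesis .
  qed
  have "(\<Sum>t\<in>S. (\<Sum>j | j \<in> J \<and> s j = t. e j) powr b)
      \<le> (\<Sum>t\<in>S. R powr (b - 1) * (\<Sum>i\<in>G. x t i powr b))"
    by (rule sum_mono) (rule slot)
  also have "\<dots> = R powr (b - 1) * (\<Sum>i\<in>G. \<Sum>t\<in>S. x t i powr b)"
    by (subst sum.swap) (simp add: sum_distrib_left)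
  also have "\<dots> \<le> R powr (b - 1) * (\<Sum>i\<in>G. (\<Sum>j | j \<in> J \<and> g j = i. e j) powr b)"
    by (intro mult_left_mono sum_mono grp) simp
  finally show ?thesis .
qed

text \<open>The offline cost is a maximum over schedules, so a bound uniform in \<open>s\<close> is
  enough.\<close>

lemma schedule_cost_le_online_cost:
  assumes "n \<ge> 1" and valid: "valid_demands T n a d e" and "b \<ge> 1"
    and s: "s \<in> schedules n a d"
  shows "schedule_cost (\<lambda>E. E powr b) T n e s
           \<le> real_of_int (r1 n a d) powr (b - 1) * online_cost (\<lambda>E. E powr b) T n a d e"
proof -
  have job: "0 < a j" "d j \<le> T" "0 < e j" if "j \<in> {1..n}" for j
    using bspec[OF valid[unfolded valid_demands_def] that] by auto
  define l L where "l = l_min n a d" and "L = l_max n a d"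
  have allow: "l \<le> allowance a d j" "allowance a d j \<le> L" if "j \<in> {1..n}" for j
    using that by (auto simp: l_def L_def l_min_def l_max_def)
  have "l \<in> allowance a d ` {1..n}"
    using \<open>n \<ge> 1\<close> unfolding l_def l_min_def by (intro Min_in) auto
  then have "l > 0" by (auto simp: allowance_def)
  obtain \<tau> m where \<tau>: "\<tau> 0 = 0"
    "\<And>i. i < m \<Longrightarrow> \<tau> i < \<tau> (Suc i) \<and> \<tau> i + l \<le> \<tau> (Suc i)"
    "online_groups T n a d = map (\<lambda>i. {j \<in> {1..n}. \<tau> i < a j \<and> a j \<le> \<tau> (Suc i)}) [0..<m]"
    "\<And>j. j \<in> {1..n} \<Longrightarrow> a j \<le> \<tau> m"
    by (rule online_groups_closing_slots[OF valid allow(1)]) blast+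
  have "\<forall>j\<in>{1..n}. \<exists>i. i < m \<and> \<tau> i < a j \<and> a j \<le> \<tau> (Suc i)"
  proof
    fix j assume j: "j \<in> {1..n}"
    have "\<tau> 0 < a j" using job(1)[OF j] by (simp add: \<tau>(1))
    then show "\<exists>i. i < m \<and> \<tau> i < a j \<and> a j \<le> \<tau> (Suc i)"
      using ex_step_interval \<tau>(4)[OF j] by blast
  qed
  from bchoice[OF this] obtain g where g: "g j < m" "\<tau> (g j) < a j" "a j \<le> \<tau> (Suc (g j))"
    if "j \<in> {1..n}" for j by blast
  \<comment> \<open>The choice of \<open>g\<close> only provides some interval containing the
    arrival; uniqueness identifies the fibres of \<open>g\<close> with the online groups.\<close>
  have group: "{j \<in> {1..n}. \<tau> i < a j \<and> a j \<le> \<tau> (Suc i)} = {j. j \<in> {1..n} \<and> g j = i}"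
    if "i < m" for i
  proof -
    have "g j = i \<longleftrightarrow> \<tau> i < a j \<and> a j \<le> \<tau> (Suc i)" if j: "j \<in> {1..n}" for j
      using step_interval_unique[OF less_imp_le, of m \<tau> "g j" "a j" i] \<tau>(2) g[OF j] \<open>i < m\<close>
      by blast
    then show ?thesis by blast
  qed
  have sj: "s j \<in> {a j..d j}" if "j \<in> {1..n}" for j
    using s that by (auto simp: schedules_def PiE_iff)
  have "schedule_cost (\<lambda>E. E powr b) T n e s
      \<le> real_of_int (r1 n a d) powr (b - 1) *
        (\<Sum>i<m. (\<Sum>j | j \<in> {1..n} \<and> g j = i. e j) powr b)"
    unfolding schedule_cost_def
  proof (rule sum_powr_regroup_le)
    fix t
    have "int (card (g ` {j \<in> {1..n}. s j = t})) \<le> \<lceil>real L / real l\<rceil> + 1"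
    proof (rule card_steps_meeting_window[of m \<tau>])
      fix i assume "i \<in> g ` {j \<in> {1..n}. s j = t}"
      then obtain j where j: "j \<in> {1..n}" "s j = t" "i = g j" by auto
      \<comment> \<open>The arrival slot is the point of the window:
        \<open>a j \<le> t \<le> d j\<close>, and the allowance is at most \<open>L\<close>.\<close>
      then have "a j \<le> t \<and> t < a j + L"
        using sj[of j] allow(2)[of j] by (auto simp: allowance_def)
      then show "\<exists>x. \<tau> i < x \<and> x \<le> \<tau> (Suc i) \<and> x \<le> t \<and> t < x + L"
        using g[of j] j by auto
    qed (use \<tau>(2) g \<open>l > 0\<close> in auto)
    then show "real (card (g ` {j \<in> {1..n}. s j = t})) \<le> real_of_int (r1 n a d)"
      unfolding r1_def l_def L_def by linarith
  next
    have "s j \<in> {1..T}" if "j \<in> {1..n}" for j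
      using sj[OF that] job[OF that] by simp
    then show "s ` {1..n} \<subseteq> {1..T}" by blast
  next
    show "e j > 0" if "j \<in> {1..n}" for j
      using job(3)[OF that] .
  qed (use g \<open>b \<ge> 1\<close> in auto)
  also have "(\<Sum>i<m. (\<Sum>j | j \<in> {1..n} \<and> g j = i. e j) powr b)
      = (\<Sum>i<m. (\<Sum>j\<in>{j \<in> {1..n}. \<tau> i < a j \<and> a j \<le> \<tau> (Suc i)}. e j) powr b)"
    by (rule sum.cong) (simp_all only: group lessThan_iff)
  also have "\<dots> = online_cost (\<lambda>E. E powr b) T n a d e"
    by (simp add: online_cost_def \<tau>(3) o_def interv_sum_list_conv_sum_set_nat atLeast0LessThan)
  finally show ?thesis .
qed

theorem theorem2:
  fixes T n :: nat
    and a d :: "nat \<Rightarrow> nat"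
    and e :: "nat \<Rightarrow> real"
    and b :: real
  assumes "n \<ge> 1"
    and "valid_demands T n a d e"
    and "b \<ge> 1"
  shows "online_cost (\<lambda>E. E powr b) T n a d e
           \<ge> 1 / real_of_int (r1 n a d) powr (b - 1) * offline_cost (\<lambda>E. E powr b) T n a d e"
proof -
  \<comment> \<open>A nonnegative ceiling makes \<open>r1\<close> positive, so its power can be
    divided out at the end.\<close>
  have "\<lceil>real (l_max n a d) / real (l_min n a d)\<rceil> \<ge> 0"
    by (simp add: order_less_le_trans[of _ 0])
  then have "r1 n a d > 0" by (simp add: r1_def)
  then have "real_of_int (r1 n a d) powr (b - 1) > 0" by simp
  moreover have "offline_cost (\<lambda>E. E powr b) T n a d e
      \<le> real_of_int (r1 n a d) powr (b - 1) * online_cost (\<lambda>E. E powr b) T n a d e"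
    unfolding offline_cost_def
    using assms schedule_cost_le_online_cost finite_schedules schedules_nonempty
    by (subst Max_le_iff) auto
  ultimately show ?thesis by (simp add: field_simps)
qed

end
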